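(* Let $(R,S)$ be a generalized Rota-Baxter system on an $A$-bimodule $M$ over an associative algebra $A$. Then for every $n\ge 0$ and every $(f,g)\in\mathrm{Hom}(M^{\otimes n},A\oplus A)$, $$d_{(R,S)}(f,g)=(-1)^n\,\delta_{\mathrm{Hoch}}(f,g),$$ where $d_{(R,S)}=\llbracket (R,S),\ \cdot\ \rrbracket$ and $\delta_{\mathrm{Hoch}}$ is the Hochschild differential of the associative algebra $(M,* )$ with coefficients in the bimodule $A\oplus A$, both as defined in the context.
   Context: All vector spaces are over a field of characteristic zero; algebras need not be unital. A generalized Rota-Baxter system on $M$ over $A$ is a pair of linear maps $R,S:M\to A$ with $R(u)R(v)=R(R(u)\cdot v+u\cdot S(v))$ and $S(u)S(v)=S(R(u)\cdot v+u\cdot S(v))$ for all $u,v\in M$. Bracket: for $F=(F_1,F_2)\in\mathrm{Hom}(M^{\otimes m},A\oplus A)$ and $G=(G_1,G_2)\in\mathrm{Hom}(M^{\otimes n},A\oplus A)$, $m,n\ge 0$, the element $\llbracket F,G\rrbracket\in\mathrm{Hom}(M^{\otimes (m+n)},A\oplus A)$ has components, for $k=1,2$, \begin{align*} \llbracket F,G\rrbracket_k(u_1,\dots,u_{m+n})=&\sum_{i=1}^m(-1)^{(i-1)n}F_k(u_1,\dots,u_{i-1},G_1(u_i,\dots,u_{i+n-1})\cdot u_{i+n},\dots,u_{m+n})\\ &-\sum_{i=1}^m(-1)^{in}F_k(u_1,\dots,u_{i-1},u_i\cdot G_2(u_{i+1},\dots,u_{i+n}),u_{i+n+1},\dots,u_{m+n})\\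 &-(-1)^{mn}\Big\{\sum_{i=1}^n(-1)^{(i-1)m}G_k(u_1,\dots,u_{i-1},F_1(u_i,\dots,u_{i+m-1})\cdot u_{i+m},\dots,u_{m+n})\\ &\qquad-\sum_{i=1}^n(-1)^{im}G_k(u_1,\dots,u_{i-1},u_i\cdot F_2(u_{i+1},\dots,u_{i+m}),u_{i+m+1},\dots,u_{m+n})\Big\}\\ &+(-1)^{mn}\big[F_k(u_1,\dots,u_m)G_k(u_{m+1},\dots,u_{m+n})-(-1)^{mn}G_k(u_1,\dots,u_n)F_k(u_{n+1},\dots,u_{m+n})\big] \end{align*} (a map with zero arguments is an element; empty sums are $0$). Hochschild side: $u*v=R(u)\cdot v+u\cdot S(v)$ is an associative product on $M$, and $A\oplus A$ is an $(M,* )$-bimodule via $l(u,(a,b))=(R(u)a-R(u\cdot b),\,S(u)b-S(u\cdot b))$ and $r((a,b),u)=(aR(u)-R(a\cdot u),\,bS(u)-S(a\cdot u))$. For $(f,g)\in\mathrm{Hom}(M^{\otimes n},A\oplus A)$, $\delta_{\mathrm{Hoch}}(f,g)\in\mathrm{Hom}(M^{\otimes(n+1)},A\oplus A)$ is \begin{align*} \delta_{\mathrm{Hoch}}(f,g)(u_1,\dots,u_{n+1})=\;&l\big(u_1,(f,g)(u_2,\dots,u_{n+1})\big)+\sum_{i=1}^n(-1)^i(f,g)(u_1,\dots,u_{i-1},u_i*u_{i+1},u_{i+2},\dots,u_{n+1})\\ &+(-1)^{n+1}r\big((f,g)(u_1,\dots,u_n),u_{n+1}\big). \end{align*} *)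

theory Defs
  imports "HOL-Analysis.Product_Vector"
begin

text \<open>The scalar multiplication \<open>sA\<close> of a vector space is explicit, so that several
  structures (the algebra \<open>A\<close>, the bimodule \<open>M\<close>, and \<open>M\<close> with its
  induced product) can be treated uniformly.  Algebras need not be unital.\<close>

locale assoc_algebra = vector_space sA
  for sA :: "'k::field_char_0 \<Rightarrow> 'a::ab_group_add \<Rightarrow> 'a" +
  fixes mA :: "'a \<Rightarrow> 'a \<Rightarrow> 'a"
  assumes linear_mult_right: "Vector_Spaces.linear sA sA (\<lambda>b. mA a b)"
    and linear_mult_left: "Vector_Spaces.linear sA sA (\<lambda>a. mA a b)"
    and mult_assoc: "mA (mA a b) c = mA a (mA b c)"

locale algebra_bimodule = A: assoc_algebra sA mA + M: vector_space sM
  for sA :: "'k::field_char_0 \<Rightarrow> 'a::ab_group_add \<Rightarrow> 'a"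
    and mA :: "'a \<Rightarrow> 'a \<Rightarrow> 'a"
    and sM :: "'k \<Rightarrow> 'm::ab_group_add \<Rightarrow> 'm" +
  fixes la :: "'a \<Rightarrow> 'm \<Rightarrow> 'm" and ra :: "'m \<Rightarrow> 'a \<Rightarrow> 'm"
  assumes linear_la_right: "Vector_Spaces.linear sM sM (\<lambda>u. la a u)"
    and linear_la_left: "Vector_Spaces.linear sA sM (\<lambda>a. la a u)"
    and linear_ra_right: "Vector_Spaces.linear sA sM (\<lambda>a. ra u a)"
    and linear_ra_left: "Vector_Spaces.linear sM sM (\<lambda>u. ra u a)"
    and la_la: "la (mA a b) u = la a (la b u)"
    and ra_ra: "ra u (mA a b) = ra (ra u a) b"
    and la_ra: "ra (la a u) b = la a (ra u b)"

locale gen_rota_baxter_system = algebra_bimodule sA mA sM la ra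
  for sA :: "'k::field_char_0 \<Rightarrow> 'a::ab_group_add \<Rightarrow> 'a"
    and mA :: "'a \<Rightarrow> 'a \<Rightarrow> 'a"
    and sM :: "'k \<Rightarrow> 'm::ab_group_add \<Rightarrow> 'm"
    and la :: "'a \<Rightarrow> 'm \<Rightarrow> 'm" and ra :: "'m \<Rightarrow> 'a \<Rightarrow> 'm" +
  fixes R S :: "'m \<Rightarrow> 'a"
  assumes linear_R: "Vector_Spaces.linear sM sA R"
    and linear_S: "Vector_Spaces.linear sM sA S"
    and R_mult: "mA (R u) (R v) = R (la (R u) v + ra u (S v))"
    and S_mult: "mA (S u) (S v) = S (la (R u) v + ra u (S v))"

text \<open>An element of \<open>Hom(M\<^sup>\<otimes>\<^sup>n, V)\<close> is represented by a map
  on lists that is linear in each entry of a list of length \<open>n\<close>; its values on lists of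
  other lengths are irrelevant, so equality in \<open>Hom(M\<^sup>\<otimes>\<^sup>n, V)\<close> is
  equality on all lists of length \<open>n\<close>.  For \<open>n = 0\<close> the element is the value at
  the empty list.\<close>

definition Hom_tensor ::
  "('k::field \<Rightarrow> 'm::ab_group_add \<Rightarrow> 'm) \<Rightarrow> ('k \<Rightarrow> 'v::ab_group_add \<Rightarrow> 'v)
    \<Rightarrow> nat \<Rightarrow> ('m list \<Rightarrow> 'v) set" where
  "Hom_tensor sM sV n =
    {F. \<forall>us i. length us = n \<longrightarrow> i < n \<longrightarrow> Vector_Spaces.linear sM sV (\<lambda>x. F (us[i := x]))}"

text \<open>Entries are counted from \<open>1\<close>: \<open>ent us i\<close> is \<open>u\<^sub>i\<close>, and \<open>seg us i j\<close> is
  \<open>u\<^sub>i, \<dots>, u\<^sub>j\<close>, which is empty for \<open>j = i - 1\<close>.\<close>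

definition ent :: "'m list \<Rightarrow> nat \<Rightarrow> 'm" where
  "ent us i = us ! (i - 1)"

definition seg :: "'m list \<Rightarrow> nat \<Rightarrow> nat \<Rightarrow> 'm list" where
  "seg us i j = map (ent us) [i..<Suc j]"

text \<open>In \<open>bracket_comp\<close> the argument \<open>p\<close> is the projection (\<open>fst\<close> or \<open>snd\<close>)
  onto the component that is computed.\<close>

definition bracket_comp ::
  "('k::field_char_0 \<Rightarrow> 'a::ab_group_add \<Rightarrow> 'a) \<Rightarrow> ('a \<Rightarrow> 'a \<Rightarrow> 'a)
    \<Rightarrow> ('a \<Rightarrow> 'm \<Rightarrow> 'm) \<Rightarrow> ('m \<Rightarrow> 'a \<Rightarrow> 'm) \<Rightarrow> nat \<Rightarrow> nat
    \<Rightarrow> ('m list \<Rightarrow> 'a \<times> 'a) \<Rightarrow> ('m list \<Rightarrow> 'a \<times> 'a) \<Rightarrow> ('a \<times> 'a \<Rightarrow> 'a)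
    \<Rightarrow> 'm list \<Rightarrow> 'a" where
  "bracket_comp sA mA la ra m n F G p us =
    (let F1 = (\<lambda>vs. fst (F vs)); F2 = (\<lambda>vs. snd (F vs)); Fk = (\<lambda>vs. p (F vs));
         G1 = (\<lambda>vs. fst (G vs)); G2 = (\<lambda>vs. snd (G vs)); Gk = (\<lambda>vs. p (G vs))
     in
      (\<Sum>i=1..m. sA ((-1) ^ ((i - 1) * n))
        (Fk (seg us 1 (i - 1) @ [la (G1 (seg us i (i + n - 1))) (ent us (i + n))]
             @ seg us (i + n + 1) (m + n))))
    - (\<Sum>i=1..m. sA ((-1) ^ (i * n))
        (Fk (seg us 1 (i - 1) @ [ra (ent us i) (G2 (seg us (i + 1) (i + n)))]
             @ seg us (i + n + 1) (m + n))))
    - sA ((-1) ^ (m * n))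
       ((\<Sum>i=1..n. sA ((-1) ^ ((i - 1) * m))
          (Gk (seg us 1 (i - 1) @ [la (F1 (seg us i (i + m - 1))) (ent us (i + m))]
               @ seg us (i + m + 1) (m + n))))
      - (\<Sum>i=1..n. sA ((-1) ^ (i * m))
          (Gk (seg us 1 (i - 1) @ [ra (ent us i) (F2 (seg us (i + 1) (i + m)))]
               @ seg us (i + m + 1) (m + n)))))
    + sA ((-1) ^ (m * n))
       (mA (Fk (seg us 1 m)) (Gk (seg us (m + 1) (m + n)))
      - sA ((-1) ^ (m * n)) (mA (Gk (seg us 1 n)) (Fk (seg us (n + 1) (m + n))))))"

definition bracket ::
  "('k::field_char_0 \<Rightarrow> 'a::ab_group_add \<Rightarrow> 'a) \<Rightarrow> ('a \<Rightarrow> 'a \<Rightarrow> 'a)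
    \<Rightarrow> ('a \<Rightarrow> 'm \<Rightarrow> 'm) \<Rightarrow> ('m \<Rightarrow> 'a \<Rightarrow> 'm) \<Rightarrow> nat \<Rightarrow> nat
    \<Rightarrow> ('m list \<Rightarrow> 'a \<times> 'a) \<Rightarrow> ('m list \<Rightarrow> 'a \<times> 'a) \<Rightarrow> 'm list \<Rightarrow> 'a \<times> 'a" where
  "bracket sA mA la ra m n F G us =
    (bracket_comp sA mA la ra m n F G fst us, bracket_comp sA mA la ra m n F G snd us)"

text \<open>The differential \<open>d\<^bsub>(R,S)\<^esub>\<close> on \<open>Hom(M\<^sup>\<otimes>\<^sup>n, A \<oplus> A)\<close>.\<close>

definition d_RS ::
  "('k::field_char_0 \<Rightarrow> 'a::ab_group_add \<Rightarrow> 'a) \<Rightarrow> ('a \<Rightarrow> 'a \<Rightarrow> 'a)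
    \<Rightarrow> ('a \<Rightarrow> 'm \<Rightarrow> 'm) \<Rightarrow> ('m \<Rightarrow> 'a \<Rightarrow> 'm) \<Rightarrow> ('m \<Rightarrow> 'a) \<Rightarrow> ('m \<Rightarrow> 'a)
    \<Rightarrow> nat \<Rightarrow> ('m list \<Rightarrow> 'a \<times> 'a) \<Rightarrow> 'm list \<Rightarrow> 'a \<times> 'a" where
  "d_RS sA mA la ra R S n = bracket sA mA la ra 1 n (\<lambda>us. (R (ent us 1), S (ent us 1)))"

text \<open>The Hochschild differential of an algebra with product \<open>mB\<close> and coefficients
  in a bimodule with scalar multiplication \<open>sV\<close> and actions \<open>l\<close>, \<open>r\<close>.\<close>

definition hochschild ::
  "('b \<Rightarrow> 'b \<Rightarrow> 'b) \<Rightarrow> ('k::field_char_0 \<Rightarrow> 'v::ab_group_add \<Rightarrow> 'v)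
    \<Rightarrow> ('b \<Rightarrow> 'v \<Rightarrow> 'v) \<Rightarrow> ('v \<Rightarrow> 'b \<Rightarrow> 'v)
    \<Rightarrow> nat \<Rightarrow> ('b list \<Rightarrow> 'v) \<Rightarrow> 'b list \<Rightarrow> 'v" where
  "hochschild mB sV l r n F us =
      l (ent us 1) (F (seg us 2 (n + 1)))
    + (\<Sum>i=1..n. sV ((-1) ^ i)
        (F (seg us 1 (i - 1) @ [mB (ent us i) (ent us (i + 1))] @ seg us (i + 2) (n + 1))))
    + sV ((-1) ^ (n + 1)) (r (F (seg us 1 n)) (ent us (n + 1)))"

definition star ::
  "('a \<Rightarrow> 'm::ab_group_add \<Rightarrow> 'm) \<Rightarrow> ('m \<Rightarrow> 'a \<Rightarrow> 'm) \<Rightarrow> ('m \<Rightarrow> 'a) \<Rightarrow> ('m \<Rightarrow> 'a)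
    \<Rightarrow> 'm \<Rightarrow> 'm \<Rightarrow> 'm" where
  "star la ra R S u v = la (R u) v + ra u (S v)"

definition lact ::
  "('a::ab_group_add \<Rightarrow> 'a \<Rightarrow> 'a) \<Rightarrow> ('m \<Rightarrow> 'a \<Rightarrow> 'm) \<Rightarrow> ('m \<Rightarrow> 'a) \<Rightarrow> ('m \<Rightarrow> 'a)
    \<Rightarrow> 'm \<Rightarrow> 'a \<times> 'a \<Rightarrow> 'a \<times> 'a" where
  "lact mA ra R S u = (\<lambda>(a, b). (mA (R u) a - R (ra u b), mA (S u) b - S (ra u b)))"

definition ract ::
  "('a::ab_group_add \<Rightarrow> 'a \<Rightarrow> 'a) \<Rightarrow> ('a \<Rightarrow> 'm \<Rightarrow> 'm) \<Rightarrow> ('m \<Rightarrow> 'a) \<Rightarrow> ('m \<Rightarrow> 'a)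
    \<Rightarrow> 'a \<times> 'a \<Rightarrow> 'm \<Rightarrow> 'a \<times> 'a" where
  "ract mA la R S = (\<lambda>(a, b) u. (mA a (R u) - R (la a u), mA b (S u) - S (la a u)))"

text \<open>The sublocales \<open>star\<close> and \<open>coeff\<close> below justify the use of \<open>hochschild\<close> for
  \<open>star\<close>, \<open>lact\<close> and \<open>ract\<close>.\<close>

context gen_rota_baxter_system
begin

lemmas additive_rules =
  A.linear_mult_right[THEN Vector_Spaces.linear.axioms(3)]
  A.linear_mult_left[THEN Vector_Spaces.linear.axioms(3)]
  linear_la_right[THEN Vector_Spaces.linear.axioms(3)]
  linear_la_left[THEN Vector_Spaces.linear.axioms(3)]
  linear_ra_right[THEN Vector_Spaces.linear.axioms(3)]
  linear_ra_left[THEN Vector_Spaces.linear.axioms(3)]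
  linear_R[THEN Vector_Spaces.linear.axioms(3)]
  linear_S[THEN Vector_Spaces.linear.axioms(3)]

lemmas lin_add = additive_rules[THEN module_hom.add]
lemmas lin_scale = additive_rules[THEN module_hom.scale]
lemmas lin_diff = additive_rules[THEN module_hom.diff]

lemma prod_scale: "module_prod.scale sA sA c x = (sA c (fst x), sA c (snd x))"
  by (simp add: module_prod.scale_def module_prod_def module_pair_def A.module_axioms)

lemma R_star: "R (star la ra R S u v) = mA (R u) (R v)"
  and S_star: "S (star la ra R S u v) = mA (S u) (S v)"
  by (simp_all add: star_def R_mult S_mult)

sublocale star: assoc_algebra sM "star la ra R S"
proof
  show "star la ra R S (star la ra R S u v) w = star la ra R S u (star la ra R S v w)" for u v w
    unfolding star_def[of la ra R S "star la ra R S u v"] star_def[of la ra R S u "star la ra R S v w"]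
      R_star S_star
    by (simp add: star_def lin_add la_la ra_ra la_ra add.assoc)
qed (simp_all add: star_def lin_add lin_scale M.scale_right_distrib ac_simps)

lemma R_mult': "mA (R u) (R v) = R (la (R u) v) + R (ra u (S v))"
  and S_mult': "mA (S u) (S v) = S (la (R u) v) + S (ra u (S v))"
  by (simp_all add: R_mult S_mult lin_add)

sublocale AA: vector_space_prod sA sA
  by unfold_locales

sublocale coeff: algebra_bimodule sM "star la ra R S" "module_prod.scale sA sA"
  "lact mA ra R S" "ract mA la R S"
proof
  show "lact mA ra R S (star la ra R S u v) x = lact mA ra R S u (lact mA ra R S v x)" for u v x
    by (cases x) (simp add: lact_def R_star S_star A.mult_assoc, simp add: lin_diff lin_add R_mult' S_mult' star_def ra_ra la_ra)
  show "ract mA la R S x (star la ra R S u v) = ract mA la R S (ract mA la R S x u) v" for u v x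
    by (cases x) (simp add: ract_def R_star S_star A.mult_assoc[symmetric], simp add: lin_diff lin_add R_mult' S_mult' star_def la_la la_ra)
  show "ract mA la R S (lact mA ra R S u x) v = lact mA ra R S u (ract mA la R S x v)" for u v x
    by (cases x) (simp add: ract_def lact_def R_star S_star A.mult_assoc lin_diff lin_add R_mult' S_mult' star_def la_la ra_ra la_ra)
qed (auto simp: prod_scale lact_def ract_def star_def lin_add lin_scale
      A.scale_right_diff_distrib split: prod.splits)

end

end

theory Submission
  imports Defs
begin

lemma length_seg [simp]: "length (seg us i j) = Suc j - i"
  by (simp add: seg_def del: upt_Suc)

lemma seg_single [simp]: "seg us i i = [ent us i]"
  by (simp add: seg_def)

lemma seg_empty [simp]: "j < i \<Longrightarrow> seg us i j = []"
  by (simp add: seg_def)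

lemma ent_single [simp]: "ent [x] (Suc 0) = x"
  by (simp add: ent_def)

text \<open>\<open>Hom_tensor\<close> states linearity through list updates. Updating position
  \<open>length xs\<close> carries it over to concatenations, the shape of the insertion
  terms.\<close>

lemma Hom_tensor_add:
  assumes "F \<in> Hom_tensor sM sV n" and "length xs + 1 + length ys = n"
  shows "F (xs @ [x + y] @ ys) = F (xs @ [x] @ ys) + F (xs @ [y] @ ys)"
proof -
  have "length (xs @ [x] @ ys) = n" "length xs < n"
    using assms(2) by auto
  with assms(1) have "Vector_Spaces.linear sM sV (\<lambda>z. F ((xs @ [x] @ ys)[length xs := z]))"
    unfolding Hom_tensor_def by blast
  then have "Vector_Spaces.linear sM sV (\<lambda>z. F (xs @ [z] @ ys))"
    by simp
  from module_hom.add[OF this[THEN Vector_Spaces.linear.axioms(3)]]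
  show ?thesis .
qed

text \<open>Clears the nested signs in the last product of the bracket and in the right-action
  term.\<close>

lemma (in vector_space) scale_minus_one_power_cancel:
  "scale ((-1) ^ n) (scale ((-1) ^ n) x) = x"
  by (simp flip: power_mult_distrib)

text \<open>Here \<open>T\<close> is the component of \<open>(R, S)\<close> selected by the projection \<open>p\<close>.
  The two insertion sums of the bracket merge because \<open>star u v\<close> is the sum of
  \<open>la (R u) v\<close> and \<open>ra u (S v)\<close>; the remaining terms regroup into the two actions.\<close>

lemma (in gen_rota_baxter_system) bracket_comp_eq_hochschild:
  assumes fg: "fg \<in> Hom_tensor sM sV n"
    and p_add: "\<And>x y. p (x + y) = p x + p y"
    and p_RS: "\<And>u. p (R u, S u) = T u"
  shows "bracket_comp sA mA la ra 1 n (\<lambda>us. (R (ent us 1), S (ent us 1))) fg p us =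
    sA ((-1) ^ n)
      (mA (T (ent us 1)) (p (fg (seg us 2 (n + 1))))
        - T (ra (ent us 1) (snd (fg (seg us 2 (n + 1)))))
      + (\<Sum>i=1..n. sA ((-1) ^ i)
          (p (fg (seg us 1 (i - 1) @ [star la ra R S (ent us i) (ent us (i + 1))]
            @ seg us (i + 2) (n + 1)))))
      + sA ((-1) ^ (n + 1))
          (mA (p (fg (seg us 1 n))) (T (ent us (n + 1)))
            - T (la (fst (fg (seg us 1 n))) (ent us (n + 1)))))"
proof -
  \<comment> \<open>\<open>L\<close> and \<open>Q\<close> are the insertions of
    \<open>(R, S)\<close> into \<open>fg\<close>: for \<open>m = 1\<close> each inner argument list
    is a single entry.\<close>
  define L where "L i = p (fg (seg us 1 (i - 1) @ [la (R (ent us i)) (ent us (i + 1))]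
    @ seg us (i + 2) (n + 1)))" for i
  define Q where "Q i = p (fg (seg us 1 (i - 1) @ [ra (ent us i) (S (ent us (i + 1)))]
    @ seg us (i + 2) (n + 1)))" for i
  \<comment> \<open>The bracket gives \<open>L i\<close> the sign \<open>(-1) ^ (i - 1)\<close> and
    \<open>Q i\<close> the sign \<open>- (-1) ^ i\<close>; the outer minus turns both into the
    Hochschild sign \<open>(-1) ^ i\<close>.\<close>
  have merge: "(\<Sum>i=1..n. sA ((-1) ^ i)
      (p (fg (seg us 1 (i - 1) @ [star la ra R S (ent us i) (ent us (i + 1))]
        @ seg us (i + 2) (n + 1)))))
    = - ((\<Sum>i=1..n. sA ((-1) ^ (i - 1)) (L i)) - (\<Sum>i=1..n. sA ((-1) ^ i) (Q i)))"
    unfolding sum_subtractf[symmetric] sum_negf[symmetric]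
  proof (rule sum.cong[OF refl])
    fix i assume i: "i \<in> {1..n}"
    \<comment> \<open>Subtraction truncates at \<open>0\<close>, so \<open>1 \<le> i\<close>
      matters.\<close>
    then have "(-1) ^ (i - 1) = (- ((-1) ^ i) :: 'k)"
      by (cases i) auto
    then show "sA ((-1) ^ i)
        (p (fg (seg us 1 (i - 1) @ [star la ra R S (ent us i) (ent us (i + 1))]
          @ seg us (i + 2) (n + 1))))
      = - (sA ((-1) ^ (i - 1)) (L i) - sA ((-1) ^ i) (Q i))"
      unfolding star_def L_def Q_def using i
      \<comment> \<open>The arity condition is \<open>(i - 1) + 1 + (n - i) = n\<close>.\<close>
      by (subst Hom_tensor_add[OF fg]) (auto simp: p_add A.scale_right_distrib)
  qed
  \<comment> \<open>Insertions into \<open>(R, S)\<close> leave one \<open>la\<close> and one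
    \<open>ra\<close> term. The right action gets the total sign
    \<open>(-1) ^ n * (-1) ^ (n + 1) = -1\<close>, the left action \<open>(-1) ^ n\<close>.\<close>
  show ?thesis
    unfolding merge
    by (simp add: bracket_comp_def p_RS L_def Q_def A.scale_right_distrib
        A.scale_right_diff_distrib A.scale_minus_one_power_cancel numeral_2_eq_2)
qed

theorem proposition3p5:
  fixes sA :: "'k::field_char_0 \<Rightarrow> 'a::ab_group_add \<Rightarrow> 'a"
    and mA :: "'a \<Rightarrow> 'a \<Rightarrow> 'a"
    and sM :: "'k \<Rightarrow> 'm::ab_group_add \<Rightarrow> 'm"
    and la :: "'a \<Rightarrow> 'm \<Rightarrow> 'm" and ra :: "'m \<Rightarrow> 'a \<Rightarrow> 'm"
    and R S :: "'m \<Rightarrow> 'a"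
    and n :: nat and fg :: "'m list \<Rightarrow> 'a \<times> 'a"
  assumes "gen_rota_baxter_system sA mA sM la ra R S"
    and "fg \<in> Hom_tensor sM (module_prod.scale sA sA) n"
  shows "\<forall>us. length us = n + 1 \<longrightarrow>
    d_RS sA mA la ra R S n fg us =
      module_prod.scale sA sA ((-1) ^ n)
        (hochschild (star la ra R S) (module_prod.scale sA sA)
          (lact mA ra R S) (ract mA la R S) n fg us)"
proof (intro allI impI)
  fix us :: "'m list"
  interpret gen_rota_baxter_system sA mA sM la ra R S by fact
  \<comment> \<open>One statement serves both components: the correction in \<open>lact\<close>
    always involves \<open>snd\<close>, that in \<open>ract\<close> always \<open>fst\<close>, and
    only \<open>p\<close> and \<open>T\<close> vary.\<close>
  note comp = bracket_comp_eq_hochschild[OF assms(2)]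
  show "d_RS sA mA la ra R S n fg us =
      module_prod.scale sA sA ((-1) ^ n)
        (hochschild (star la ra R S) (module_prod.scale sA sA)
          (lact mA ra R S) (ract mA la R S) n fg us)"
    unfolding d_RS_def bracket_def comp[of fst R, OF fst_add fst_conv]
      comp[of snd S, OF snd_add snd_conv] prod_scale hochschild_def
    by (simp add: lact_def ract_def case_prod_unfold fst_sum snd_sum)
qed

end
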